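(* Let $n\ge1$, $\alpha\in[0,1]$ and $\theta\in\Omega$. The point $\theta^\ast\in M$ minimising $\theta'\mapsto D_\alpha(\theta\,\|\,\theta')$ over $\theta'\in M$ (with $\theta$ held fixed as first argument) is given by $\theta^{\ast,i}=\bar\theta:=\tfrac1n\sum_j\theta^j$ for every $i$, independently of $\alpha$.
   Context: $\Omega:=\{\theta\in\mathbb R^n:\sum_ie^{\theta^i}<1\}$; on $\Omega$, $\Psi_+(\theta):=\log(1+\sum_ie^{\theta^i})$, $\Psi_-(\theta):=-\log(1-\sum_ie^{\theta^i})$, $\Psi_\alpha:=\alpha\Psi_++(1-\alpha)\Psi_-$. $\Psi_\alpha^*(\eta):=\sup_{\theta\in\Omega}[\theta\cdot\eta-\Psi_\alpha(\theta)]$ is the Legendre dual. For $\theta,\theta'\in\Omega$, with $\eta(\theta'):=\nabla\Psi_\alpha(\theta')$, the canonical divergence is $D_\alpha(\theta\,\|\,\theta'):=\Psi_\alpha(\theta)+\Psi_\alpha^*(\eta(\theta'))-\theta\cdot\eta(\theta')$. $M:=\{\theta\in\Omega:\theta^1=\theta^2=\cdots=\theta^n\}$. *)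

theory Defs
  imports "HOL-Analysis.Analysis"
begin

definition Omega :: "(real ^ 'n::finite) set" where
  "Omega = {\<theta>. (\<Sum>i\<in>UNIV. exp (\<theta> $ i)) < 1}"

text \<open>The potentials below are only meaningful on \<open>Omega\<close>; they are total functions,
  but every use is restricted to this open set.\<close>

definition Psi_plus :: "real ^ 'n::finite \<Rightarrow> real" where
  "Psi_plus \<theta> = ln (1 + (\<Sum>i\<in>UNIV. exp (\<theta> $ i)))"

definition Psi_minus :: "real ^ 'n::finite \<Rightarrow> real" where
  "Psi_minus \<theta> = - ln (1 - (\<Sum>i\<in>UNIV. exp (\<theta> $ i)))"

definition Psi :: "real \<Rightarrow> real ^ 'n::finite \<Rightarrow> real" where
  "Psi \<alpha> \<theta> = \<alpha> * Psi_plus \<theta> + (1 - \<alpha>) * Psi_minus \<theta>"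

definition gradient :: "('a::real_inner \<Rightarrow> real) \<Rightarrow> 'a \<Rightarrow> 'a" where
  "gradient f x = (THE D. GDERIV f x :> D)"

text \<open>The supremum is taken in the extended reals, so that it has its usual meaning
  also at those \<open>\<eta>\<close> where it is infinite.\<close>

definition Psi_dual :: "real \<Rightarrow> real ^ 'n::finite \<Rightarrow> ereal" where
  "Psi_dual \<alpha> \<eta> = (SUP \<theta>\<in>Omega. ereal (\<theta> \<bullet> \<eta> - Psi \<alpha> \<theta>))"

definition eta :: "real \<Rightarrow> real ^ 'n::finite \<Rightarrow> real ^ 'n" where
  "eta \<alpha> \<theta> = gradient (Psi \<alpha>) \<theta>"

definition canonical_divergence :: "real \<Rightarrow> real ^ 'n::finite \<Rightarrow> real ^ 'n \<Rightarrow> ereal" where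
  "canonical_divergence \<alpha> \<theta> \<theta>' =
     ereal (Psi \<alpha> \<theta>) + Psi_dual \<alpha> (eta \<alpha> \<theta>') - ereal (\<theta> \<bullet> eta \<alpha> \<theta>')"

definition M :: "(real ^ 'n::finite) set" where
  "M = {\<theta>\<in>Omega. \<forall>i j. \<theta> $ i = \<theta> $ j}"

end

theory Submission
  imports Defs
begin

text \<open>
  Write \<open>\<Psi>\<^sub>\<alpha>(\<theta>) = L(S)\<close> with \<open>S = \<Sum>\<^sub>i exp \<theta>\<^sup>i\<close>; the profile \<open>L\<close> is increasing.
  At a point \<open>c\<one>\<close> of \<open>M\<close> the gradient is a multiple of \<open>\<one> = (1,\<dots>,1)\<close>, so it sees a point
  \<open>\<theta>\<close> only through its mean \<open>t\<close>. By Jensen \<open>n exp t \<le> S\<close>, hence \<open>\<Psi>\<^sub>\<alpha>(t\<one>) \<le> \<Psi>\<^sub>\<alpha>(\<theta>)\<close>, and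
  the tangent inequality for \<open>\<Psi>\<^sub>\<alpha>\<close> at \<open>c\<one>\<close> reduces to the one for the strictly convex
  function \<open>g(t) = L(n exp t)\<close> of one variable. It shows that the supremum defining the dual
  at \<open>\<eta>(c\<one>)\<close> is attained at \<open>c\<one>\<close>, so \<open>D\<^sub>\<alpha>(\<theta> \<parallel> c\<one>) = \<Psi>\<^sub>\<alpha>(\<theta>) - g(c) - g'(c) (t - c)\<close>,
  which is smallest exactly at \<open>c = t\<close>.
\<close>

lemma gradient_eqI:
  assumes "GDERIV f x :> D"
  shows "gradient f x = D"
  unfolding gradient_def
proof (rule the_equality)
  show "GDERIV f x :> D"
    by (fact assms)
  fix D' assume "GDERIV f x :> D'"
  with assms have "(\<lambda>h. h \<bullet> D') = (\<lambda>h. h \<bullet> D)"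
    unfolding gderiv_def by (rule has_derivative_unique[rotated])
  then have "h \<bullet> D' = h \<bullet> D" for h
    by meson
  then have "(D' - D) \<bullet> (D' - D) = 0"
    by (metis inner_diff_right right_minus_eq)
  then show "D' = D"
    by simp
qed

text \<open>By the mean value theorem the chord from \<open>c\<close> to \<open>t\<close> has slope
  \<open>f' z\<close> with \<open>z\<close> strictly between them; strict growth of
  \<open>f'\<close> compares this slope with \<open>f' c\<close> on either side of
  \<open>c\<close>.\<close>

lemma tangent_less_of_deriv_strict_mono:
  fixes f f' :: "real \<Rightarrow> real"
  assumes deriv: "\<And>x. x < b \<Longrightarrow> (f has_real_derivative f' x) (at x)"
    and mono: "strict_mono_on {..<b} f'"
    and "c < b" "t < b" "t \<noteq> c"
  shows "f c + f' c * (t - c) < f t"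
proof (cases "c < t")
  case True
  then obtain z where "c < z" "z < t" "f t - f c = (t - c) * f' z"
    using MVT2[of c t f f'] deriv \<open>t < b\<close> by fastforce
  moreover have "f' c < f' z"
    using mono \<open>c < z\<close> \<open>z < t\<close> \<open>t < b\<close> by (auto simp: strict_mono_on_def)
  then have "(t - c) * f' c < (t - c) * f' z"
    using True by simp
  ultimately show ?thesis
    by (simp add: algebra_simps)
next
  case False
  then have "t < c"
    using \<open>t \<noteq> c\<close> by simp
  then obtain z where "t < z" "z < c" "f c - f t = (c - t) * f' z"
    using MVT2[of t c f f'] deriv \<open>c < b\<close> by fastforce
  moreover have "f' z < f' c"
    using mono \<open>z < c\<close> \<open>c < b\<close> by (auto simp: strict_mono_on_def)
  then have "(c - t) * f' z < (c - t) * f' c"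
    using \<open>t < c\<close> by simp
  ultimately show ?thesis
    by (simp add: algebra_simps)
qed

lemma exp_mean_le_sum_exp:
  fixes \<theta> :: "real ^ 'n::finite"
  shows "CARD('n) * exp ((\<Sum>i\<in>UNIV. \<theta> $ i) / CARD('n)) \<le> (\<Sum>i\<in>UNIV. exp (\<theta> $ i))"
proof -
  define t where "t = (\<Sum>i\<in>UNIV. \<theta> $ i) / CARD('n)"
  \<comment> \<open>Tangent line of \<open>exp\<close> at the mean \<open>t\<close>. In the sum over
    \<open>i\<close> the linear terms cancel, since deviations from the mean add up to 0.\<close>
  have "exp t * (1 + (\<theta> $ i - t)) \<le> exp t * exp (\<theta> $ i - t)" for i
    by (intro mult_left_mono exp_ge_add_one_self) simp
  then have "(\<Sum>i\<in>UNIV. exp t * (1 + (\<theta> $ i - t))) \<le> (\<Sum>i\<in>UNIV. exp (\<theta> $ i))"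
    by (intro sum_mono) (simp flip: exp_add)
  moreover have "(\<Sum>i\<in>UNIV. exp t * (1 + (\<theta> $ i - t))) = CARD('n) * exp t"
    by (simp flip: sum_distrib_left add: sum.distrib sum_subtractf t_def)
  ultimately show ?thesis
    by (simp add: t_def)
qed

text \<open>This is L of the overview, taken as a function of the exponential sum.\<close>

definition profile :: "real \<Rightarrow> real \<Rightarrow> real" where
  "profile \<alpha> x = \<alpha> * ln (1 + x) - (1 - \<alpha>) * ln (1 - x)"

definition profile_deriv :: "real \<Rightarrow> real \<Rightarrow> real" where
  "profile_deriv \<alpha> x = \<alpha> / (1 + x) + (1 - \<alpha>) / (1 - x)"

lemma Psi_eq_profile: "Psi \<alpha> \<theta> = profile \<alpha> (\<Sum>i\<in>UNIV. exp (\<theta> $ i))"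
  by (simp add: Psi_def Psi_plus_def Psi_minus_def profile_def)

lemma profile_has_real_derivative:
  assumes "0 \<le> x" "x < 1"
  shows "(profile \<alpha> has_real_derivative profile_deriv \<alpha> x) (at x)"
  unfolding profile_def[abs_def] profile_deriv_def
  using assms by (auto intro!: derivative_eq_intros)

lemma profile_mono:
  assumes "0 \<le> \<alpha>" "\<alpha> \<le> 1" "0 \<le> x" "x \<le> y" "y < 1"
  shows "profile \<alpha> x \<le> profile \<alpha> y"
  unfolding profile_def using assms by (intro diff_mono mult_left_mono) auto

text \<open>For x = exp s the product is the derivative of L(exp s) in s, so its strict growth is
  what makes g strictly convex. Both x/(1+x) and x/(1-x) increase strictly below 1.\<close>

lemma times_profile_deriv_strict_mono:
  assumes "0 \<le> \<alpha>" "\<alpha> \<le> 1" "0 < x" "x < y" "y < 1"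
  shows "x * profile_deriv \<alpha> x < y * profile_deriv \<alpha> y"
proof -
  have plus: "x / (1 + x) < y / (1 + y)" and minus: "x / (1 - x) < y / (1 - y)"
    using assms by (auto simp: field_simps)
  have "\<alpha> * (x / (1 + x)) + (1 - \<alpha>) * (x / (1 - x)) < \<alpha> * (y / (1 + y)) + (1 - \<alpha>) * (y / (1 - y))"
  \<comment> \<open>One of the two weights may vanish: strictness comes from the minus term if
    \<open>\<alpha> = 0\<close>, and from the plus term otherwise.\<close>
  proof (cases "\<alpha> = 0")
    case False
    with assms plus minus show ?thesis
      by (intro add_less_le_mono mult_strict_left_mono mult_left_mono) auto
  qed (use minus in simp)
  then show ?thesis
    by (simp add: profile_deriv_def algebra_simps)
qed

lemma GDERIV_Psi:
  fixes \<theta> :: "real ^ 'n::finite"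
  assumes "\<theta> \<in> Omega"
  shows "GDERIV (Psi \<alpha>) \<theta> :> (\<chi> i. exp (\<theta> $ i) * profile_deriv \<alpha> (\<Sum>i\<in>UNIV. exp (\<theta> $ i)))"
proof -
  define S where "S \<theta> = (\<Sum>i\<in>UNIV. exp (\<theta> $ i))" for \<theta> :: "real ^ 'n"
  have "(S has_derivative (\<lambda>h. \<Sum>i\<in>UNIV. exp (\<theta> $ i) * h $ i)) (at \<theta>)"
    unfolding S_def[abs_def]
    by (auto intro!: derivative_eq_intros bounded_linear.has_derivative[OF bounded_linear_vec_nth]
        simp: mult.commute)
  moreover have "(profile \<alpha> has_derivative (*) (profile_deriv \<alpha> (S \<theta>))) (at (S \<theta>))"
    using assms profile_has_real_derivative[of "S \<theta>" \<alpha>]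
    by (simp add: Omega_def S_def sum_nonneg has_field_derivative_def)
  ultimately have "((\<lambda>\<theta>. profile \<alpha> (S \<theta>)) has_derivative
      (\<lambda>h. profile_deriv \<alpha> (S \<theta>) * (\<Sum>i\<in>UNIV. exp (\<theta> $ i) * h $ i))) (at \<theta>)"
    by (rule has_derivative_compose)
  moreover have "Psi \<alpha> = (\<lambda>\<theta>. profile \<alpha> (S \<theta>))"
    by (simp add: Psi_eq_profile S_def fun_eq_iff)
  moreover have "(\<lambda>h. profile_deriv \<alpha> (S \<theta>) * (\<Sum>i\<in>UNIV. exp (\<theta> $ i) * h $ i))
      = (\<lambda>h. h \<bullet> (\<chi> i. exp (\<theta> $ i) * profile_deriv \<alpha> (S \<theta>)))"
    by (auto simp: inner_vec_def sum_distrib_left mult_ac)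
  ultimately show ?thesis
    by (simp add: gderiv_def S_def)
qed

text \<open>This is g of the overview. The \<open>itself\<close> argument carries the dimension,
  which the real arguments do not determine.\<close>

definition diag_Psi :: "'n::finite itself \<Rightarrow> real \<Rightarrow> real \<Rightarrow> real" where
  "diag_Psi _ \<alpha> t = profile \<alpha> (CARD('n) * exp t)"

definition diag_Psi_deriv :: "'n::finite itself \<Rightarrow> real \<Rightarrow> real \<Rightarrow> real" where
  "diag_Psi_deriv _ \<alpha> t = CARD('n) * exp t * profile_deriv \<alpha> (CARD('n) * exp t)"

text \<open>The bound is the right end of the diagonal inside \<open>Omega\<close>: it makes
  \<open>M\<close> an open half-line, the domain of g.\<close>

lemma card_exp_less_1_iff: "CARD('n::finite) * exp t < 1 \<longleftrightarrow> t < - ln (CARD('n))"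
proof -
  have "CARD('n) * exp t < 1 \<longleftrightarrow> exp t < 1 / CARD('n)"
    by (simp add: field_simps)
  also have "1 / CARD('n) = exp (- ln (CARD('n)))"
    by (simp add: exp_minus inverse_eq_divide)
  finally show ?thesis
    by simp
qed

lemma diag_mem_Omega_iff:
  "((\<chi> i. c) :: real ^ 'n::finite) \<in> Omega \<longleftrightarrow> c < - ln (CARD('n))"
  by (simp add: Omega_def flip: card_exp_less_1_iff)

lemma Psi_diag: "Psi \<alpha> ((\<chi> i. c) :: real ^ 'n::finite) = diag_Psi TYPE('n) \<alpha> c"
  by (simp add: Psi_eq_profile diag_Psi_def)

text \<open>All coordinates of the gradient at a diagonal point agree, so only the coordinate sum of
  \<open>\<theta>\<close> enters; passing to the mean supplies the factor n in
  \<open>diag_Psi_deriv\<close>.\<close>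

lemma inner_eta_diag:
  fixes \<theta> :: "real ^ 'n::finite"
  assumes "((\<chi> i. c) :: real ^ 'n) \<in> Omega"
  shows "\<theta> \<bullet> eta \<alpha> (\<chi> i. c) = (\<Sum>i\<in>UNIV. \<theta> $ i) / CARD('n) * diag_Psi_deriv TYPE('n) \<alpha> c"
  unfolding eta_def gradient_eqI[OF GDERIV_Psi[OF assms]]
  by (simp add: inner_vec_def diag_Psi_deriv_def flip: sum_distrib_right)

lemma diag_Psi_tangent_less:
  fixes c t \<alpha> :: real
  assumes "0 \<le> \<alpha>" "\<alpha> \<le> 1" and b: "c < - ln (CARD('n::finite))" "t < - ln (CARD('n))" and "t \<noteq> c"
  shows "diag_Psi TYPE('n) \<alpha> c + diag_Psi_deriv TYPE('n) \<alpha> c * (t - c) < diag_Psi TYPE('n) \<alpha> t"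
proof (rule tangent_less_of_deriv_strict_mono[OF _ _ b \<open>t \<noteq> c\<close>])
  fix x assume "x < - ln (CARD('n))"
  then have "CARD('n) * exp x < 1"
    by (simp only: card_exp_less_1_iff)
  then have "((\<lambda>t. profile \<alpha> (CARD('n) * exp t)) has_real_derivative
      profile_deriv \<alpha> (CARD('n) * exp x) * (CARD('n) * exp x)) (at x)"
    by (intro DERIV_chain2[OF profile_has_real_derivative]) (auto intro!: derivative_eq_intros)
  then show "(diag_Psi TYPE('n) \<alpha> has_real_derivative diag_Psi_deriv TYPE('n) \<alpha> x) (at x)"
    by (simp add: diag_Psi_def[abs_def] diag_Psi_deriv_def mult_ac)
next
  show "strict_mono_on {..<- ln (CARD('n))} (diag_Psi_deriv TYPE('n) \<alpha>)"
  proof (rule strict_mono_onI)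
    fix r s assume "s \<in> {..<- ln (CARD('n))}" "r < s"
    then have "CARD('n) * exp s < 1"
      by (simp add: card_exp_less_1_iff)
    with assms \<open>r < s\<close> show "diag_Psi_deriv TYPE('n) \<alpha> r < diag_Psi_deriv TYPE('n) \<alpha> s"
      unfolding diag_Psi_deriv_def by (intro times_profile_deriv_strict_mono) auto
  qed
qed

lemma diag_Psi_tangent_le:
  fixes c t \<alpha> :: real
  assumes "0 \<le> \<alpha>" "\<alpha> \<le> 1" "c < - ln (CARD('n::finite))" "t < - ln (CARD('n))"
  shows "diag_Psi TYPE('n) \<alpha> c + diag_Psi_deriv TYPE('n) \<alpha> c * (t - c) \<le> diag_Psi TYPE('n) \<alpha> t"
  using diag_Psi_tangent_less[where 'n='n, OF assms] by (cases "t = c") auto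

lemma mean_less_of_mem_Omega:
  fixes \<theta> :: "real ^ 'n::finite"
  assumes "\<theta> \<in> Omega"
  shows "(\<Sum>i\<in>UNIV. \<theta> $ i) / CARD('n) < - ln (CARD('n))"
  using exp_mean_le_sum_exp[of \<theta>] assms
  unfolding card_exp_less_1_iff[symmetric] Omega_def by simp

lemma diag_Psi_mean_le_Psi:
  fixes \<theta> :: "real ^ 'n::finite"
  assumes "0 \<le> \<alpha>" "\<alpha> \<le> 1" "\<theta> \<in> Omega"
  shows "diag_Psi TYPE('n) \<alpha> ((\<Sum>i\<in>UNIV. \<theta> $ i) / CARD('n)) \<le> Psi \<alpha> \<theta>"
  unfolding diag_Psi_def Psi_eq_profile
  using assms exp_mean_le_sum_exp[of \<theta>] by (intro profile_mono) (auto simp: Omega_def)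

lemma Psi_dual_eta_diag:
  assumes "0 \<le> \<alpha>" "\<alpha> \<le> 1" and c: "((\<chi> i. c) :: real ^ 'n::finite) \<in> Omega"
  shows "Psi_dual \<alpha> (eta \<alpha> ((\<chi> i. c) :: real ^ 'n))
    = ereal (c * diag_Psi_deriv TYPE('n) \<alpha> c - diag_Psi TYPE('n) \<alpha> c)"
  unfolding Psi_dual_def
proof (rule antisym)
  show "(SUP \<theta>\<in>Omega. ereal (\<theta> \<bullet> eta \<alpha> ((\<chi> i. c) :: real ^ 'n) - Psi \<alpha> \<theta>))
    \<le> ereal (c * diag_Psi_deriv TYPE('n) \<alpha> c - diag_Psi TYPE('n) \<alpha> c)"
  proof (rule SUP_least)
    \<comment> \<open>Jensen first replaces \<open>Psi \<alpha> \<theta>\<close> by g at the mean of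
      \<open>\<theta>\<close>; the tangent of g at \<open>c\<close> then bounds that value from
      below.\<close>
    fix \<theta> :: "real ^ 'n" assume \<theta>: "\<theta> \<in> Omega"
    show "ereal (\<theta> \<bullet> eta \<alpha> (\<chi> i. c) - Psi \<alpha> \<theta>)
      \<le> ereal (c * diag_Psi_deriv TYPE('n) \<alpha> c - diag_Psi TYPE('n) \<alpha> c)"
      using diag_Psi_tangent_le[where 'n='n, OF assms(1,2) _ mean_less_of_mem_Omega[OF \<theta>], of c]
        diag_Psi_mean_le_Psi[OF assms(1,2) \<theta>] c
      by (simp add: inner_eta_diag diag_mem_Omega_iff algebra_simps)
  qed
next
  have "(\<chi> i. c) \<bullet> eta \<alpha> ((\<chi> i. c) :: real ^ 'n) - Psi \<alpha> ((\<chi> i. c) :: real ^ 'n)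
    = c * diag_Psi_deriv TYPE('n) \<alpha> c - diag_Psi TYPE('n) \<alpha> c"
    using c by (simp add: inner_eta_diag Psi_diag)
  then show "ereal (c * diag_Psi_deriv TYPE('n) \<alpha> c - diag_Psi TYPE('n) \<alpha> c)
    \<le> (SUP \<theta>\<in>Omega. ereal (\<theta> \<bullet> eta \<alpha> ((\<chi> i. c) :: real ^ 'n) - Psi \<alpha> \<theta>))"
    by (intro SUP_upper2[OF c]) simp
qed

text \<open>The dual is finite here, so the divergence is real: the height of
  \<open>Psi \<alpha> \<theta>\<close> above the tangent of g at \<open>c\<close>, read off at the
  mean. Only the tangent depends on \<open>c\<close>.\<close>

lemma canonical_divergence_diag:
  fixes \<theta> :: "real ^ 'n::finite"
  assumes "0 \<le> \<alpha>" "\<alpha> \<le> 1" and "((\<chi> i. c) :: real ^ 'n) \<in> Omega"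
  shows "canonical_divergence \<alpha> \<theta> (\<chi> i. c) = ereal (Psi \<alpha> \<theta> - (diag_Psi TYPE('n) \<alpha> c
    + diag_Psi_deriv TYPE('n) \<alpha> c * ((\<Sum>i\<in>UNIV. \<theta> $ i) / CARD('n) - c)))"
  using assms
  by (simp add: canonical_divergence_def Psi_dual_eta_diag inner_eta_diag algebra_simps)

lemma mem_M_iff: "\<theta> \<in> M \<longleftrightarrow> \<theta> \<in> Omega \<and> (\<exists>c. \<theta> = (\<chi> i. c))"
proof
  assume "\<theta> \<in> M"
  \<comment> \<open>Any coordinate gives the common value; \<open>undefined\<close> picks
    one.\<close>
  then have "\<theta> = (\<chi> i. \<theta> $ undefined)" "\<theta> \<in> Omega"
    by (auto simp: M_def vec_eq_iff)
  then show "\<theta> \<in> Omega \<and> (\<exists>c. \<theta> = (\<chi> i. c))"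
    by blast
qed (auto simp: M_def)

lemma is_arg_min_iff_strict_min:
  fixes f :: "'a \<Rightarrow> 'b::order"
  assumes "P x" and "\<And>y. P y \<Longrightarrow> y \<noteq> x \<Longrightarrow> f x < f y"
  shows "is_arg_min f P z \<longleftrightarrow> z = x"
  using assms unfolding is_arg_min_def by (metis order.asym order.irrefl)

theorem theorem7p4:
  fixes \<alpha> :: real and \<theta> \<theta>s :: "real ^ 'n::finite"
  assumes "0 \<le> \<alpha>" and "\<alpha> \<le> 1" and "\<theta> \<in> Omega"
  shows "is_arg_min (\<lambda>\<theta>'. canonical_divergence \<alpha> \<theta> \<theta>') (\<lambda>\<theta>'. \<theta>' \<in> M) \<theta>s
    \<longleftrightarrow> \<theta>s = (\<chi> i. (1 / real CARD('n)) * (\<Sum>j\<in>UNIV. \<theta> $ j))"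
proof -
  define t where "t = (\<Sum>j\<in>UNIV. \<theta> $ j) / CARD('n)"
  have t: "t < - ln (CARD('n))"
    unfolding t_def by (rule mean_less_of_mem_Omega[OF assms(3)])
  have "is_arg_min (\<lambda>\<theta>'. canonical_divergence \<alpha> \<theta> \<theta>') (\<lambda>\<theta>'. \<theta>' \<in> M) \<theta>s
    \<longleftrightarrow> \<theta>s = (\<chi> i. t)"
  proof (rule is_arg_min_iff_strict_min)
    show "(\<chi> i. t) \<in> (M :: (real ^ 'n) set)"
      using t by (auto simp: mem_M_iff diag_mem_Omega_iff)
  next
    fix \<theta>' :: "real ^ 'n" assume "\<theta>' \<in> M" and neq: "\<theta>' \<noteq> (\<chi> i. t)"
    then obtain c where c: "\<theta>' = (\<chi> i. c)" "c < - ln (CARD('n))"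
      by (auto simp: mem_M_iff diag_mem_Omega_iff)
    with neq have "t \<noteq> c"
      by auto
    \<comment> \<open>At the mean \<open>t\<close> the tangent of g at \<open>t\<close> has height
      g(t), while the tangent at any other \<open>c\<close> lies strictly lower, which makes the
      divergence strictly larger.\<close>
    from diag_Psi_tangent_less[where 'n='n, OF assms(1,2) c(2) t this]
    show "canonical_divergence \<alpha> \<theta> (\<chi> i. t) < canonical_divergence \<alpha> \<theta> \<theta>'"
      using assms c t
      by (simp add: canonical_divergence_diag diag_mem_Omega_iff flip: t_def)
  qed
  then show ?thesis
    by (simp add: t_def)
qed

end
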